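(* Let $G$ be a graph of order $n$ with at least one edge. Then: (i) $G^*$ has an even number of stable sets; moreover, the number of stable sets of $G^*$ (i.e. $I(G^*;1)$) is divisible by $2^{n-\alpha(G)}$. (ii) For $x\notin\{-1,0\}$, $x^n\, I(G^*;1/x)=(1+x)^n\, I(G;1/(1+x))$; equivalently $I(G^*;x)=(1+x)^n I(G;x/(1+x))$ for $x\neq -1$, and $I(G^*;x-1)=x^n I(G;1-1/x)$ for $x\ne 0$; in particular $I(G^*;-2)=(-1)^n I(G;2)$. (iii) There is a bijection between the set of roots of $I(G^*;x)$ different from $-1$ and the set of roots of $I(G;x)$ which respects the multiplicities of the roots; moreover, under this bijection rational roots correspond to rational roots and real roots correspond to real roots. (iv) $-1$ is a root of $I(G^*;x)$ of multiplicity exactly $\alpha(G^* )-\alpha(G)\ge 1$. (v) For every positive integer $k$ there exists a well-covered tree $H_k$ such that $I(H_k;-1/k)=0$. (vi) If $x<-1$, then $I(G^*;x)\neq 0$; moreover, if $n$ is odd then $I(G^*;x)<0$ for all $x<-1$, while if $n$ is even then $I(G^*;x)>0$ for all $x<-1$.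
   Context: Graphs are finite and simple. A stable set is a set of pairwise non-adjacent vertices (the empty set included); $\alpha(G)$ is the maximum size of a stable set. With $s_k$ the number of stable sets of size $k$ in $G$, the independence polynomial is $I(G;x)=\sum_{k=0}^{\alpha(G)} s_kx^k$. For a graph $G$ with vertices $v_1,\dots,v_n$, $G^*$ is obtained by adding new vertices $u_1,\dots,u_n$ and edges $u_iv_i$, i.e., attaching one pendant edge to each vertex of $G$; $\alpha(G^* )=n$. A graph is well-covered if all its maximal stable sets have the same cardinality. Roots are counted in $\mathbb{C}$. *)

theory Defs
  imports
    Complex_Main
    "HOL-Computational_Algebra.Polynomial"
    "Graph_Theory.Graph_Theory"
begin

text \<open>
  Finite simple graphs are the symmetric loop-free finite digraphs of the locale
  \<open>pair_graph\<close>: an edge \<open>uv\<close> is the pair of arcs \<open>(u,v)\<close>, \<open>(v,u)\<close>.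
\<close>

definition stable_set :: "'a pair_pre_digraph \<Rightarrow> 'a set \<Rightarrow> bool" where
  "stable_set G S \<longleftrightarrow> S \<subseteq> pverts G \<and> (\<forall>u\<in>S. \<forall>v\<in>S. (u, v) \<notin> parcs G)"

definition stability_number :: "'a pair_pre_digraph \<Rightarrow> nat" where
  "stability_number G = Max (card ` {S. stable_set G S})"

definition num_stable_sets :: "'a pair_pre_digraph \<Rightarrow> nat \<Rightarrow> nat" where
  "num_stable_sets G k = card {S. stable_set G S \<and> card S = k}"

definition indep_poly :: "'a pair_pre_digraph \<Rightarrow> 'c::comm_semiring_1 poly" where
  "indep_poly G = (\<Sum>k=0..stability_number G. monom (of_nat (num_stable_sets G k)) k)"

text \<open>The graph \<open>G\<^sup>*\<close>: the vertex \<open>v\<close> of \<open>G\<close> is \<open>Inl v\<close>, its pendant neighbour is \<open>Inr v\<close>.\<close>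

definition pendant_graph :: "'a pair_pre_digraph \<Rightarrow> ('a + 'a) pair_pre_digraph" where
  "pendant_graph G = \<lparr>
     pverts = Inl ` pverts G \<union> Inr ` pverts G,
     parcs = {(Inl u, Inl v) | u v. (u, v) \<in> parcs G}
           \<union> {(Inl v, Inr v) | v. v \<in> pverts G}
           \<union> {(Inr v, Inl v) | v. v \<in> pverts G} \<rparr>"

lemma pair_graph_pendant_graph:
  assumes "pair_graph G"
  shows "pair_graph (pendant_graph G)"
proof -
  interpret pair_graph G by (fact assms)
  have "parcs (pendant_graph G) \<subseteq> pverts (pendant_graph G) \<times> pverts (pendant_graph G)"
    by (auto simp: pendant_graph_def dest: in_arcsD1 in_arcsD2)
  moreover have "finite (pverts (pendant_graph G))"
    by (simp add: pendant_graph_def)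
  ultimately have "finite (parcs (pendant_graph G))"
    by (meson finite_SigmaI finite_subset)
  then show ?thesis
    by unfold_locales
       (auto simp: pendant_graph_def symmetric_def sym_def
             intro: arcs_symmetric dest: in_arcsD1 in_arcsD2 no_loops')
qed

definition maximal_stable_set :: "'a pair_pre_digraph \<Rightarrow> 'a set \<Rightarrow> bool" where
  "maximal_stable_set G S \<longleftrightarrow> stable_set G S \<and> (\<forall>T. stable_set G T \<and> S \<subseteq> T \<longrightarrow> T = S)"

definition well_covered :: "'a pair_pre_digraph \<Rightarrow> bool" where
  "well_covered G \<longleftrightarrow>
     (\<forall>S T. maximal_stable_set G S \<and> maximal_stable_set G T \<longrightarrow> card S = card T)"

text \<open>
  The library's \<^const>\<open>tree\<close> is not usable here: for it the two arcs of an edge already form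
  a cycle. A cycle of a simple graph has at least three edges.
\<close>

definition tree_graph :: "'a pair_pre_digraph \<Rightarrow> bool" where
  "tree_graph G \<longleftrightarrow> pair_graph G \<and> Digraph_Component.connected (with_proj G)
     \<and> \<not> (\<exists>p. pre_digraph.cycle (with_proj G) p \<and> 3 \<le> length p)"

end

theory Submission
  imports Defs "HOL-Library.Nat_Bijection"
begin

text \<open>
  A stable set of \<open>G\<^sup>*\<close> consists of a stable set \<open>S\<close> of \<open>G\<close> together with the pendant
  neighbours of an arbitrary set of vertices outside \<open>S\<close>. Therefore \<open>I(G\<^sup>*; x)\<close> is the sum of
  \<open>x\<^bsup>card S\<^esup> (1 + x)\<^bsup>n - card S\<^esup>\<close> over the stable sets \<open>S\<close> of \<open>G\<close>, that is,
  \<open>(1 + x)\<^sup>n I(G; x / (1 + x))\<close> for \<open>x \<noteq> -1\<close>. The Moebius map \<open>x / (1 + x)\<close> transports the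
  roots with their multiplicities, the factor \<open>1 + x\<close> can be taken out of the sum exactly
  \<open>n - \<alpha>(G)\<close> times, and all terms of the sum at \<open>x = 1\<close> are divisible by
  \<open>2\<^bsup>n - \<alpha>(G)\<^esup>\<close>.
\<close>

section \<open>Stable sets and the independence polynomial\<close>

lemma finite_stable_sets:
  assumes "finite (pverts G)"
  shows "finite {S. stable_set G S}"
  by (rule finite_subset[of _ "Pow (pverts G)"]) (use assms in \<open>auto simp: stable_set_def\<close>)

lemma stable_set_finite:
  assumes "finite (pverts G)" "stable_set G S"
  shows "finite S"
  using assms by (auto simp: stable_set_def intro: finite_subset)

lemma stable_set_empty [simp]: "stable_set G {}"
  by (simp add: stable_set_def)

lemma card_stable_set_le:
  assumes "finite (pverts G)" "stable_set G S"
  shows "card S \<le> stability_number G"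
  unfolding stability_number_def
  by (rule Max_ge) (use assms finite_stable_sets[OF assms(1)] in auto)

lemma stability_number_attained:
  assumes "finite (pverts G)"
  obtains S where "stable_set G S" "card S = stability_number G"
proof -
  have "stability_number G \<in> card ` {S. stable_set G S}"
    unfolding stability_number_def
    by (rule Max_in) (use finite_stable_sets[OF assms] in \<open>auto intro: stable_set_empty\<close>)
  then show ?thesis using that by auto
qed

lemma stability_number_le_order:
  assumes "finite (pverts G)"
  shows "stability_number G \<le> card (pverts G)"
  using stability_number_attained[OF assms] assms
  by (metis card_mono stable_set_def)

text \<open>A stable set as large as the whole vertex set would contain both ends of an edge. This
  makes the exponent \<open>n - stability_number G\<close> positive in (i) and (iv).\<close>

lemma stability_number_less_order:
  assumes "pair_graph G" "parcs G \<noteq> {}"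
  shows "stability_number G < card (pverts G)"
proof -
  interpret pair_graph G by fact
  obtain S where S: "stable_set G S" "card S = stability_number G"
    using stability_number_attained pair_finite_verts by blast
  obtain u v where uv: "(u, v) \<in> parcs G"
    using assms(2) by auto
  then have "u \<in> pverts G" "v \<in> pverts G"
    by (auto dest: in_arcsD1 in_arcsD2)
  with S uv have "S \<subset> pverts G"
    by (auto simp: stable_set_def)
  then show ?thesis
    using S(2) psubset_card_mono[OF pair_finite_verts] by metis
qed

text \<open>Grouping stable sets by size gives the coefficients; \<open>[:0, 1:]\<close> is the
  indeterminate. The form as a sum over sets can be reindexed along bijections, and over any
  commutative semiring it can be evaluated in \<open>nat\<close> as well as in \<open>real\<close>
  and \<open>complex\<close>.\<close>

lemma indep_poly_eq_sum:
  fixes G :: "'a pair_pre_digraph"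
  assumes "finite (pverts G)"
  shows "(indep_poly G :: 'c::comm_semiring_1 poly) = (\<Sum>S | stable_set G S. [:0, 1:] ^ card S)"
proof -
  have "(indep_poly G :: 'c poly) =
      (\<Sum>k=0..stability_number G. \<Sum>S | S \<in> {S. stable_set G S} \<and> card S = k. [:0, 1:] ^ card S)"
    unfolding indep_poly_def
  proof (rule sum.cong[OF refl])
    fix k
    have "(\<Sum>S | S \<in> {S. stable_set G S} \<and> card S = k. [:0, 1:] ^ card S :: 'c poly)
        = of_nat (num_stable_sets G k) * [:0, 1:] ^ k"
      by (simp add: num_stable_sets_def)
    then show "monom (of_nat (num_stable_sets G k)) k
        = (\<Sum>S | S \<in> {S. stable_set G S} \<and> card S = k. [:0, 1:] ^ card S :: 'c poly)"
      by (simp add: monom_altdef of_nat_poly)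
  qed
  also have "\<dots> = (\<Sum>S | stable_set G S. [:0, 1:] ^ card S)"
    by (rule sum.group)
       (use finite_stable_sets[OF assms] card_stable_set_le[OF assms] in auto)
  finally show ?thesis .
qed

lemma poly_indep_poly:
  assumes "finite (pverts G)"
  shows "poly (indep_poly G) x = (\<Sum>S | stable_set G S. x ^ card S)"
  by (simp add: indep_poly_eq_sum[OF assms] poly_sum poly_power)

text \<open>The value at 1 counts the stable sets, and the empty set is one of them.\<close>

lemma indep_poly_nonzero:
  assumes "finite (pverts G)"
  shows "(indep_poly G :: 'c::{comm_semiring_1, semiring_char_0} poly) \<noteq> 0"
proof -
  have "poly (indep_poly G) (1 :: 'c) = of_nat (card {S. stable_set G S})"
    by (simp add: poly_indep_poly[OF assms])
  moreover have "card {S. stable_set G S} \<noteq> 0"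
    using finite_stable_sets[OF assms] stable_set_empty[of G] by (auto simp del: stable_set_empty)
  ultimately show ?thesis
    by (metis of_nat_eq_0_iff poly_0)
qed

lemma degree_indep_poly_le:
  assumes "finite (pverts G)"
  shows "degree (indep_poly G) \<le> card (pverts G)"
  unfolding indep_poly_def
proof (rule degree_sum_le)
  fix k assume "k \<in> {0..stability_number G}"
  then have "k \<le> card (pverts G)"
    using stability_number_le_order[OF assms] by simp
  then show "degree (monom (of_nat (num_stable_sets G k)) k) \<le> card (pverts G)"
    using degree_monom_le order_trans by blast
qed simp

section \<open>The graph with pendant edges\<close>

lemma finite_pverts_pendant_graph:
  "finite (pverts G) \<Longrightarrow> finite (pverts (pendant_graph G))"
  by (simp add: pendant_graph_def)

text \<open>Pendant vertices are pairwise non-adjacent and \<open>Inr v\<close> has the single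
  neighbour \<open>Inl v\<close>, so \<open>T\<close> only has to avoid \<open>S\<close>.\<close>

lemma stable_set_pendant_graph_Plus:
  "stable_set (pendant_graph G) (S <+> T) \<longleftrightarrow> stable_set G S \<and> T \<subseteq> pverts G - S"
  by (auto simp: stable_set_def pendant_graph_def Plus_def ball_Un)

lemma set_eq_Plus: "W = (Inl -` W) <+> (Inr -` W)"
proof (rule set_eqI)
  fix w show "w \<in> W \<longleftrightarrow> w \<in> (Inl -` W) <+> (Inr -` W)"
    by (cases w) auto
qed

lemma Plus_eq_iff: "S <+> T = S' <+> T' \<longleftrightarrow> S = S' \<and> T = T'"
  by (auto simp: set_eq_iff Plus_def)

lemma bij_betw_stable_sets_pendant_graph:
  "bij_betw (\<lambda>(S, T). S <+> T) (SIGMA S:{S. stable_set G S}. Pow (pverts G - S))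
     {W. stable_set (pendant_graph G) W}"
  unfolding bij_betw_def
proof (intro conjI subset_antisym subsetI)
  show "inj_on (\<lambda>(S, T). S <+> T) (SIGMA S:{S. stable_set G S}. Pow (pverts G - S))"
    by (auto simp: inj_on_def Plus_eq_iff)
next
  fix W assume "W \<in> (\<lambda>(S, T). S <+> T) ` (SIGMA S:{S. stable_set G S}. Pow (pverts G - S))"
  then show "W \<in> {W. stable_set (pendant_graph G) W}"
    using stable_set_pendant_graph_Plus by fastforce
next
  fix W assume "W \<in> {W. stable_set (pendant_graph G) W}"
  then have "stable_set G (Inl -` W) \<and> Inr -` W \<subseteq> pverts G - Inl -` W"
    using stable_set_pendant_graph_Plus[of G "Inl -` W" "Inr -` W"] set_eq_Plus[of W] by simp
  then have "(Inl -` W, Inr -` W) \<in> (SIGMA S:{S. stable_set G S}. Pow (pverts G - S))"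
    by auto
  then show "W \<in> (\<lambda>(S, T). S <+> T) ` (SIGMA S:{S. stable_set G S}. Pow (pverts G - S))"
    using set_eq_Plus[of W] by (metis (mono_tags, lifting) case_prod_conv image_eqI)
qed

text \<open>Expanding the product of the factors \<open>x + 1\<close> over \<open>A\<close>, each
  subset \<open>T\<close> records the factors that contribute \<open>x\<close>.\<close>

lemma sum_Pow_power_card:
  fixes x :: "'c::comm_semiring_1"
  assumes "finite A"
  shows "(\<Sum>T\<in>Pow A. x ^ card T) = (1 + x) ^ card A"
  using prod_add[OF assms, of "\<lambda>_. x" "\<lambda>_. 1"] by (simp add: add.commute)

text \<open>For a fixed \<open>S\<close>, summing over the free choice of pendant vertices outside
  \<open>S\<close> gives a power of \<open>1 + x\<close>. Being an identity of polynomials, it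
  remains usable at -1, where the Moebius form breaks down.\<close>

lemma indep_poly_pendant_graph:
  fixes G :: "'a pair_pre_digraph"
  assumes "finite (pverts G)"
  shows "(indep_poly (pendant_graph G) :: 'c::comm_semiring_1 poly) =
    (\<Sum>S | stable_set G S. [:0, 1:] ^ card S * [:1, 1:] ^ (card (pverts G) - card S))"
proof -
  let ?X = "[:0, 1:] :: 'c poly"
  have "indep_poly (pendant_graph G) = (\<Sum>W | stable_set (pendant_graph G) W. ?X ^ card W)"
    by (rule indep_poly_eq_sum[OF finite_pverts_pendant_graph[OF assms]])
  also have "\<dots> = (\<Sum>(S, T)\<in>(SIGMA S:{S. stable_set G S}. Pow (pverts G - S)). ?X ^ card (S <+> T))"
    by (subst sum.reindex_bij_betw[OF bij_betw_stable_sets_pendant_graph, symmetric])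
       (simp add: case_prod_unfold)
  also have "\<dots> = (\<Sum>S | stable_set G S. \<Sum>T\<in>Pow (pverts G - S). ?X ^ card (S <+> T))"
    by (subst sum.Sigma) (use assms finite_stable_sets[OF assms] in auto)
  also have "\<dots> = (\<Sum>S | stable_set G S. ?X ^ card S * [:1, 1:] ^ (card (pverts G) - card S))"
  proof (rule sum.cong[OF refl])
    fix S assume "S \<in> {S. stable_set G S}"
    then have S: "S \<subseteq> pverts G" "finite S"
      using stable_set_finite[OF assms] by (auto simp: stable_set_def)
    have "(\<Sum>T\<in>Pow (pverts G - S). ?X ^ card (S <+> T))
        = (\<Sum>T\<in>Pow (pverts G - S). ?X ^ card S * ?X ^ card T)"
      using assms S(2)
      by (intro sum.cong refl) (auto simp: card_Plus finite_subset[of _ "pverts G - S"] power_add)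
    also have "\<dots> = ?X ^ card S * (1 + ?X) ^ card (pverts G - S)"
      using assms by (simp add: sum_Pow_power_card flip: sum_distrib_left)
    also have "1 + ?X = [:1, 1:]"
      by (simp add: one_pCons)
    finally show "(\<Sum>T\<in>Pow (pverts G - S). ?X ^ card (S <+> T))
        = ?X ^ card S * [:1, 1:] ^ (card (pverts G) - card S)"
      using S by (simp add: card_Diff_subset)
  qed
  finally show ?thesis .
qed

lemma poly_indep_poly_pendant_graph:
  assumes "finite (pverts G)"
  shows "poly (indep_poly (pendant_graph G)) x
    = (\<Sum>S | stable_set G S. x ^ card S * (1 + x) ^ (card (pverts G) - card S))"
  by (simp add: indep_poly_pendant_graph[OF assms] poly_sum poly_power)

lemma poly_indep_poly_pendant_graph_moebius:
  fixes x :: "'c::field"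
  assumes "finite (pverts G)" "x \<noteq> -1"
  shows "poly (indep_poly (pendant_graph G)) x
    = (1 + x) ^ card (pverts G) * poly (indep_poly G) (x / (1 + x))"
proof -
  have nz: "1 + x \<noteq> 0"
    using assms(2) by (metis add_eq_0_iff)
  have "x ^ card S * (1 + x) ^ (card (pverts G) - card S)
      = (1 + x) ^ card (pverts G) * (x / (1 + x)) ^ card S" if "stable_set G S" for S
  proof -
    have "card S \<le> card (pverts G)"
      using that assms(1) by (auto simp: stable_set_def intro: card_mono)
    then show ?thesis
      using nz by (simp add: power_diff power_divide)
  qed
  then show ?thesis
    by (simp add: poly_indep_poly_pendant_graph[OF assms(1)] poly_indep_poly[OF assms(1)]
                  sum_distrib_left)
qed

text \<open>The two halves of a stable set project to disjoint subsets of \<open>pverts G\<close>,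
  which gives the upper bound; the set of all pendant vertices attains it.\<close>

lemma stability_number_pendant_graph:
  assumes "finite (pverts G)"
  shows "stability_number (pendant_graph G) = card (pverts G)"
proof (rule antisym)
  obtain W where W: "stable_set (pendant_graph G) W" "card W = stability_number (pendant_graph G)"
    using stability_number_attained finite_pverts_pendant_graph[OF assms] by blast
  have T: "stable_set G (Inl -` W)" "Inr -` W \<subseteq> pverts G - Inl -` W"
    using W(1) stable_set_pendant_graph_Plus[of G "Inl -` W" "Inr -` W"] set_eq_Plus[of W] by auto
  have fin: "finite (Inl -` W)" "finite (Inr -` W)"
    using T assms by (auto simp: stable_set_def intro: finite_subset)
  have "card W = card (Inl -` W) + card (Inr -` W)"
    using set_eq_Plus[of W] card_Plus[OF fin] by simp
  also have "\<dots> = card (Inl -` W \<union> Inr -` W)"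
    using fin T by (intro card_Un_disjoint[symmetric]) auto
  also have "\<dots> \<le> card (pverts G)"
    using assms T by (intro card_mono) (auto simp: stable_set_def)
  finally show "stability_number (pendant_graph G) \<le> card (pverts G)"
    using W(2) by simp
next
  have "stable_set (pendant_graph G) ({} <+> pverts G)"
    by (simp add: stable_set_pendant_graph_Plus)
  from card_stable_set_le[OF finite_pverts_pendant_graph[OF assms] this]
  show "card (pverts G) \<le> stability_number (pendant_graph G)"
    using assms by (simp add: card_Plus)
qed

text \<open>A maximal stable set contains every pendant vertex whose neighbour it misses, hence
  exactly one end of each pendant edge.\<close>

lemma well_covered_pendant_graph:
  assumes "finite (pverts G)"
  shows "well_covered (pendant_graph G)"
proof -
  have "card W = card (pverts G)" if "maximal_stable_set (pendant_graph G) W" for W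
  proof -
    define S where "S = Inl -` W"
    define T where "T = Inr -` W"
    have W: "W = S <+> T"
      unfolding S_def T_def by (rule set_eq_Plus)
    have ST: "stable_set G S" "T \<subseteq> pverts G - S"
      using that by (auto simp: maximal_stable_set_def W stable_set_pendant_graph_Plus)
    then have "stable_set (pendant_graph G) (S <+> (pverts G - S))"
      by (simp add: stable_set_pendant_graph_Plus)
    moreover have "W \<subseteq> S <+> (pverts G - S)"
      using ST by (auto simp: W)
    ultimately have "S <+> (pverts G - S) = W"
      using that by (simp add: maximal_stable_set_def)
    moreover have "S \<subseteq> pverts G" "finite S"
      using ST assms by (auto simp: stable_set_def intro: finite_subset)
    ultimately show ?thesis
      using assms card_Plus[of S "pverts G - S"] card_mono[of "pverts G" S]
      by (auto simp: card_Diff_subset)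
  qed
  then show ?thesis
    by (simp add: well_covered_def)
qed

section \<open>Multiplicities of roots\<close>

lemma order_linear_power_mult:
  fixes q :: "'c::idom poly"
  assumes "poly q a \<noteq> 0"
  shows "order a ([:- a, 1:] ^ m * q) = m"
proof -
  have "[:- a, 1:] ^ m * q \<noteq> 0"
    using assms by auto
  then show ?thesis
    using assms by (simp add: order_mult order_power_n_n order_0I)
qed

lemma homogenization_exists:
  fixes q :: "'c::field poly"
  assumes "degree q \<le> d"
  obtains h where "\<And>x. x \<noteq> -1 \<Longrightarrow> poly h x = (1 + x) ^ d * poly q (x / (1 + x))"
proof
  fix x :: 'c assume "x \<noteq> -1"
  then have nz: "1 + x \<noteq> 0"
    by (metis add_eq_0_iff)
  have "coeff q i * (x ^ i * (1 + x) ^ (d - i)) = (1 + x) ^ d * (coeff q i * (x / (1 + x)) ^ i)"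
    if "i \<le> degree q" for i
    using that assms nz by (simp add: power_diff power_divide)
  then have "(\<Sum>i\<le>degree q. coeff q i * (x ^ i * (1 + x) ^ (d - i)))
      = (\<Sum>i\<le>degree q. (1 + x) ^ d * (coeff q i * (x / (1 + x)) ^ i))"
    by (intro sum.cong refl) simp
  \<comment> \<open>The witness \<open>h\<close> is the polynomial on the left: the power
    \<open>(1 + x) ^ d\<close> clears all denominators of \<open>q\<close> at
    \<open>x / (1 + x)\<close>.\<close>
  then show "poly (\<Sum>i\<le>degree q. smult (coeff q i) ([:0, 1:] ^ i * [:1, 1:] ^ (d - i))) x
      = (1 + x) ^ d * poly q (x / (1 + x))"
    by (simp add: poly_sum poly_power poly_altdef[of q] sum_distrib_left)
qed

text \<open>Split off the root \<open>b = a / (1 + a)\<close> of \<open>p\<close> with its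
  multiplicity \<open>m\<close>. Since \<open>x / (1 + x) - b\<close> is \<open>x - a\<close> times
  a factor that does not vanish at \<open>a\<close>, the polynomial \<open>r\<close> is
  \<open>(x - a) ^ m\<close> times a polynomial that is nonzero at \<open>a\<close>.\<close>

lemma order_moebius:
  fixes p r :: "'c::field_char_0 poly"
  assumes r: "\<And>x. x \<noteq> -1 \<Longrightarrow> poly r x = (1 + x) ^ n * poly p (x / (1 + x))"
    and p: "p \<noteq> 0" "degree p \<le> n" and a: "a \<noteq> -1"
  shows "order a r = order (a / (1 + a)) p"
proof -
  define b where "b = a / (1 + a)"
  define m where "m = order b p"
  have nza: "1 + a \<noteq> 0"
    using a by (metis add_eq_0_iff)
  have b1: "1 - b = 1 / (1 + a)"
    using nza by (simp add: b_def field_simps)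
  obtain q where q: "p = [:- b, 1:] ^ m * q" "\<not> [:- b, 1:] dvd q"
    using order_decomp[OF p(1)] unfolding m_def by blast
  have qb: "poly q b \<noteq> 0"
    using q(2) by (simp add: poly_eq_0_iff_dvd)
  have "q \<noteq> 0"
    using qb by auto
  \<comment> \<open>The \<open>m\<close> linear factors use up \<open>m\<close> of the
    \<open>n\<close> factors \<open>1 + x\<close>; enough remain to clear the denominators of
    \<open>q\<close>.\<close>
  then have deg: "m + degree q \<le> n"
    using p(2) q(1) by (simp add: degree_mult_eq degree_power_eq)
  then have "degree q \<le> n - m"
    by simp
  then obtain h where h: "\<And>x. x \<noteq> -1 \<Longrightarrow> poly h x = (1 + x) ^ (n - m) * poly q (x / (1 + x))"
    using homogenization_exists by blast
  define s where "s = [:- a, 1:] ^ m * smult ((1 - b) ^ m) h"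
  have "poly r x = poly s x" if x: "x \<noteq> -1" for x
  proof -
    have nzx: "1 + x \<noteq> 0"
      using x by (metis add_eq_0_iff)
    have "x / (1 + x) - b = (x - a) * (1 - b) / (1 + x)"
      unfolding b1 using nza nzx by (simp add: b_def field_simps)
    then have "poly p (x / (1 + x)) = ((x - a) * (1 - b) / (1 + x)) ^ m * poly q (x / (1 + x))"
      by (simp add: q(1) poly_power)
    moreover have "(1 + x) ^ n = (1 + x) ^ (n - m) * (1 + x) ^ m"
      using deg by (simp flip: power_add)
    ultimately have "poly r x = (x - a) ^ m * (1 - b) ^ m * ((1 + x) ^ (n - m) * poly q (x / (1 + x)))"
      using nzx by (simp add: r[OF x] power_divide power_mult_distrib)
    then show ?thesis
      by (simp add: s_def poly_power h[OF x])
  qed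
  \<comment> \<open>Agreement is known only away from -1, but these are infinitely many points, so
    \<open>r\<close> and \<open>s\<close> are equal as polynomials.\<close>
  then have "UNIV - {-1} \<subseteq> {x. poly (r - s) x = 0}"
    by auto
  moreover have "infinite (UNIV - {-1 :: 'c})"
    by (simp add: infinite_UNIV_char_0)
  ultimately have "r - s = 0"
    using poly_roots_finite[of "r - s"] finite_subset by blast
  then have "order a r = order a s"
    by simp
  also have "\<dots> = m"
    unfolding s_def
    by (rule order_linear_power_mult) (use b1 nza qb h[OF a] in \<open>simp add: b_def\<close>)
  finally show ?thesis
    by (simp add: m_def b_def)
qed

text \<open>After \<open>(1 + x) ^ (n - \<alpha>)\<close> is taken out, only the maximum stable sets
  contribute to the cofactor \<open>Q\<close> at -1. They all have the same sign, so they cannot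
  cancel.\<close>

lemma order_minus_one_indep_poly_pendant_graph:
  fixes G :: "'a pair_pre_digraph"
  assumes "finite (pverts G)"
  shows "order (-1 :: 'c::{idom, ring_char_0}) (indep_poly (pendant_graph G))
    = card (pverts G) - stability_number G"
proof -
  let ?n = "card (pverts G)" and ?\<alpha> = "stability_number G"
  define Q :: "'c poly" where
    "Q = (\<Sum>S | stable_set G S. [:0, 1:] ^ card S * [:1, 1:] ^ (?\<alpha> - card S))"
  have "indep_poly (pendant_graph G) = [:1, 1:] ^ (?n - ?\<alpha>) * Q"
    unfolding indep_poly_pendant_graph[OF assms] Q_def sum_distrib_left
  proof (rule sum.cong[OF refl])
    fix S assume "S \<in> {S. stable_set G S}"
    then have "?n - card S = (?n - ?\<alpha>) + (?\<alpha> - card S)"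
      using card_stable_set_le[OF assms, of S] stability_number_le_order[OF assms] by simp
    then show "[:0, 1 :: 'c:] ^ card S * [:1, 1:] ^ (?n - card S)
        = [:1, 1:] ^ (?n - ?\<alpha>) * ([:0, 1:] ^ card S * [:1, 1:] ^ (?\<alpha> - card S))"
      by (simp add: power_add mult_ac)
  qed
  moreover have "poly Q (-1) \<noteq> 0"
  proof -
    \<comment> \<open>The factor \<open>1 + x\<close> becomes 0 here, and
      \<open>0 ^ (?\<alpha> - card S)\<close> is 1 exactly when the exponent is 0.\<close>
    have "poly Q (-1) = (\<Sum>S | stable_set G S. if card S = ?\<alpha> then (-1) ^ ?\<alpha> else 0)"
      unfolding Q_def poly_sum
    proof (rule sum.cong[OF refl])
      fix S assume "S \<in> {S. stable_set G S}"
      then show "poly ([:0, 1 :: 'c:] ^ card S * [:1, 1:] ^ (?\<alpha> - card S)) (-1)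
          = (if card S = ?\<alpha> then (-1) ^ ?\<alpha> else 0)"
        using card_stable_set_le[OF assms, of S] by (auto simp: poly_power)
    qed
    also have "\<dots> = of_nat (num_stable_sets G ?\<alpha>) * (-1) ^ ?\<alpha>"
      by (simp add: num_stable_sets_def finite_stable_sets[OF assms] flip: sum.inter_filter)
    finally have "poly Q (-1) = of_nat (num_stable_sets G ?\<alpha>) * (-1) ^ ?\<alpha>" .
    moreover have "num_stable_sets G ?\<alpha> \<noteq> 0"
      using stability_number_attained[OF assms] finite_stable_sets[OF assms]
      by (auto simp: num_stable_sets_def)
    ultimately show ?thesis
      by simp
  qed
  ultimately show ?thesis
    using order_linear_power_mult[of Q "-1" "?n - ?\<alpha>"] by simp
qed

section \<open>Well-covered trees\<close>

text \<open>Attaching pendant edges changes the vertex type from \<open>'a\<close> to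
  \<open>'a + 'a\<close>. Renaming the vertices returns to a fixed type, so that the construction
  can be iterated by induction.\<close>

definition relabel :: "('a \<Rightarrow> 'b) \<Rightarrow> 'a pair_pre_digraph \<Rightarrow> 'b pair_pre_digraph" where
  "relabel f G = \<lparr>pverts = f ` pverts G, parcs = map_prod f f ` parcs G\<rparr>"

lemma relabel_simps [simp]:
  "pverts (relabel f G) = f ` pverts G"
  "parcs (relabel f G) = map_prod f f ` parcs G"
  by (simp_all add: relabel_def)

lemma pair_graph_relabel:
  assumes "pair_graph G" "inj f"
  shows "pair_graph (relabel f G)"
proof -
  interpret pair_graph G by fact
  show ?thesis
    by unfold_locales
       (use \<open>inj f\<close> in \<open>auto simp: symmetric_def sym_def inj_eq intro: arcs_symmetric
          dest: in_arcsD1 in_arcsD2 no_loops'\<close>)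
qed

lemma stable_set_relabel_image:
  assumes "inj f"
  shows "stable_set (relabel f G) (f ` S) \<longleftrightarrow> stable_set G S"
  using assms by (auto simp: stable_set_def inj_image_mem_iff inj_image_subset_iff inj_eq)

lemma stable_set_relabelE:
  assumes "stable_set (relabel f G) W"
  obtains S where "W = f ` S"
  using assms by (auto simp: stable_set_def subset_image_iff)

lemma bij_betw_stable_sets_relabel:
  assumes "inj f"
  shows "bij_betw ((`) f) {S. stable_set G S} {W. stable_set (relabel f G) W}"
  unfolding bij_betw_def
proof (intro conjI subset_antisym subsetI)
  show "inj_on ((`) f) {S. stable_set G S}"
    using assms by (simp add: inj_on_def inj_image_eq_iff)
next
  fix W assume "W \<in> {W. stable_set (relabel f G) W}"
  then show "W \<in> (`) f ` {S. stable_set G S}"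
    using stable_set_relabel_image[OF assms] by (metis image_eqI mem_Collect_eq stable_set_relabelE)
qed (use stable_set_relabel_image[OF assms] in auto)

lemma poly_indep_poly_relabel:
  assumes "inj f" "finite (pverts G)"
  shows "poly (indep_poly (relabel f G)) x = poly (indep_poly G) x"
proof -
  have "poly (indep_poly (relabel f G)) x = (\<Sum>W | stable_set (relabel f G) W. x ^ card W)"
    using assms(2) by (simp add: poly_indep_poly)
  also have "\<dots> = (\<Sum>S | stable_set G S. x ^ card (f ` S))"
    by (rule sum.reindex_bij_betw[OF bij_betw_stable_sets_relabel[OF assms(1)], symmetric])
  also have "\<dots> = poly (indep_poly G) x"
    using assms by (simp add: poly_indep_poly card_image[OF inj_on_subset[OF assms(1)]])
  finally show ?thesis .
qed

lemma maximal_stable_set_relabel_image: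
  assumes "inj f"
  shows "maximal_stable_set (relabel f G) (f ` S) \<longleftrightarrow> maximal_stable_set G S"
proof -
  have "(\<forall>T. stable_set (relabel f G) T \<and> f ` S \<subseteq> T \<longrightarrow> T = f ` S)
      \<longleftrightarrow> (\<forall>T. stable_set (relabel f G) (f ` T) \<and> f ` S \<subseteq> f ` T \<longrightarrow> f ` T = f ` S)"
    by (metis stable_set_relabelE)
  then show ?thesis
    using assms
    by (simp add: maximal_stable_set_def stable_set_relabel_image inj_image_subset_iff
        inj_image_eq_iff)
qed

lemma well_covered_relabel:
  assumes "inj f" "well_covered G"
  shows "well_covered (relabel f G)"
  unfolding well_covered_def
proof (intro allI impI)
  fix S T assume ST: "maximal_stable_set (relabel f G) S \<and> maximal_stable_set (relabel f G) T"
  then obtain S' T' where eq: "S = f ` S'" "T = f ` T'"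
    by (meson maximal_stable_set_def stable_set_relabelE)
  then have "card S' = card T'"
    using ST assms by (simp add: maximal_stable_set_relabel_image well_covered_def)
  then show "card S = card T"
    using assms(1) eq by (simp add: card_image[OF inj_on_subset[OF assms(1)]])
qed

section \<open>Connectedness and cycles in terms of arcs\<close>

lemma connected_iff_rtrancl:
  assumes "pair_graph G"
  shows "Digraph_Component.connected (with_proj G) \<longleftrightarrow>
    pverts G \<noteq> {} \<and> (\<forall>u\<in>pverts G. \<forall>v\<in>pverts G. (u, v) \<in> (parcs G)\<^sup>*)"
proof -
  interpret pair_graph G by fact
  \<comment> \<open>Reachability is reflexive only on vertices, whereas \<open>rtrancl\<close> is
    reflexive everywhere; hence the condition on \<open>u\<close>.\<close>
  have "u \<rightarrow>\<^sup>*\<^bsub>with_proj G\<^esub> v \<longleftrightarrow> (u, v) \<in> (parcs G)\<^sup>*" if "u \<in> pverts G" for u v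
  proof
    assume "u \<rightarrow>\<^sup>*\<^bsub>with_proj G\<^esub> v"
    then show "(u, v) \<in> (parcs G)\<^sup>*"
      using reachable_rtranclI by fastforce
  next
    assume "(u, v) \<in> (parcs G)\<^sup>*"
    then show "u \<rightarrow>\<^sup>*\<^bsub>with_proj G\<^esub> v"
    proof (induction rule: rtrancl_induct)
      case base
      then show ?case using that by simp
    next
      case (step y z)
      then show ?case by (simp add: reachable_adj_trans)
    qed
  qed
  moreover have "symmetric (with_proj G)"
    by (rule pair_sym_arcs)
  ultimately show ?thesis
    by (simp add: Digraph_Component.connected_def strongly_connected_def reachable_mk_symmetric_eq)
qed

lemma rtrancl_map:
  assumes "(u, v) \<in> R\<^sup>*" "\<And>a b. (a, b) \<in> R \<Longrightarrow> (f a, f b) \<in> R'"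
  shows "(f u, f v) \<in> R'\<^sup>*"
  using assms(1) by induction (auto intro: assms(2) rtrancl.rtrancl_into_rtrancl)

lemma pcas_map: "pcas u p v \<Longrightarrow> pcas (f u) (map (map_prod f f) p) (f v)"
  by (induction u p v rule: pcas.induct) auto

lemma pcas_snd_nth:
  assumes "pcas u p v" "Suc i < length p"
  shows "fst (p ! Suc i) = snd (p ! i)"
  using assms
proof (induction u p v arbitrary: i rule: pcas.induct)
  case (2 u e es v)
  then show ?case by (cases i; cases es) auto
qed simp

text \<open>The last arc of a closed walk ends where the first one starts, so consecutive arcs can
  be indexed modulo the length, without rotating the walk.\<close>

lemma pcas_closed_nth:
  assumes "pcas u p u" "i < length p"
  shows "fst (p ! (Suc i mod length p)) = snd (p ! i)"
proof (cases "Suc i < length p")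
  case True
  then show ?thesis using pcas_snd_nth[OF assms(1)] by simp
next
  case False
  have "p \<noteq> []"
    using assms(2) by auto
  have "pcas u p v \<Longrightarrow> p \<noteq> [] \<Longrightarrow> fst (hd p) = u \<and> snd (last p) = v" for u v
    by (induction u p v rule: pcas.induct) auto
  with assms(1) \<open>p \<noteq> []\<close> have "fst (hd p) = snd (last p)"
    by simp
  moreover have "Suc i = length p"
    using False assms(2) by simp
  ultimately show ?thesis
    using \<open>p \<noteq> []\<close> by (metis diff_Suc_1 hd_conv_nth last_conv_nth mod_self)
qed

text \<open>The vertices of a walk are its start followed by the heads of its arcs, so distinctness
  concerns the heads only; the start is the tail of the first arc.\<close>

lemma cycle_with_proj_iff:
  assumes "pair_wf_digraph G"
  shows "pre_digraph.cycle (with_proj G) p \<longleftrightarrow>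
    p \<noteq> [] \<and> set p \<subseteq> parcs G \<and> distinct (map snd p) \<and> pcas (fst (hd p)) p (fst (hd p))"
proof -
  interpret pair_wf_digraph G by fact
  have verts: "pawalk_verts u p = u # map snd p" if "pcas u p v" for u v
    using that by (induction u p v rule: pcas.induct) auto
  show ?thesis
  proof
    assume "cycle p"
    then obtain u where u: "set p \<subseteq> parcs G" "pcas u p u" "distinct (tl (pawalk_verts u p))" "p \<noteq> []"
      unfolding cycle_def awalk_def by blast
    moreover have "fst (hd p) = u"
      using u(2,4) by (cases p) auto
    ultimately show "p \<noteq> [] \<and> set p \<subseteq> parcs G \<and> distinct (map snd p)
        \<and> pcas (fst (hd p)) p (fst (hd p))"
      using verts by simp
  next
    assume p: "p \<noteq> [] \<and> set p \<subseteq> parcs G \<and> distinct (map snd p)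
        \<and> pcas (fst (hd p)) p (fst (hd p))"
    then have "fst (hd p) \<in> pverts G"
      by (cases p) (auto dest: in_arcsD1)
    with p show "cycle p"
      unfolding cycle_def awalk_def using verts by (metis list.sel(3))
  qed
qed

text \<open>Every vertex of a cycle is the head of one of its arcs, so injectivity on the heads
  suffices. This admits maps that are not injective globally, such as \<open>inv f\<close> or the
  projection of a pendant vertex to its neighbour.\<close>

lemma cycle_map:
  assumes "pair_wf_digraph G" "pair_wf_digraph H" "pre_digraph.cycle (with_proj G) p"
    and "map_prod f f ` set p \<subseteq> parcs H" "inj_on f (snd ` set p)"
  shows "pre_digraph.cycle (with_proj H) (map (map_prod f f) p)"
proof -
  have p: "p \<noteq> []" "distinct (map snd p)" "pcas (fst (hd p)) p (fst (hd p))"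
    using assms(1,3) by (auto simp: cycle_with_proj_iff)
  have "map snd (map (map_prod f f) p) = map f (map snd p)"
    by simp
  moreover have "distinct (map f (map snd p))"
    using p(2) assms(5) by (simp only: distinct_map set_map)
  moreover have "fst (hd (map (map_prod f f) p)) = f (fst (hd p))"
    using p(1) by (cases p) auto
  ultimately show ?thesis
    using p assms(2,4) pcas_map[OF p(3), of f]
    by (simp add: cycle_with_proj_iff)
qed

lemma pair_graph_imp_pair_wf_digraph: "pair_graph G \<Longrightarrow> pair_wf_digraph G"
  by (simp add: pair_graph_def pair_digraph_def pair_fin_digraph_def)

lemma tree_graph_relabel:
  assumes "tree_graph G" "inj f"
  shows "tree_graph (relabel f G)"
proof -
  have G: "pair_graph G"
    using assms(1) by (simp add: tree_graph_def)
  have H: "pair_graph (relabel f G)"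
    by (rule pair_graph_relabel[OF G assms(2)])
  have "(f u, f v) \<in> (parcs (relabel f G))\<^sup>*" if "u \<in> pverts G" "v \<in> pverts G" for u v
    by (rule rtrancl_map[of _ _ "parcs G"])
       (use that assms(1) connected_iff_rtrancl[OF G] in \<open>auto simp: tree_graph_def\<close>)
  then have "Digraph_Component.connected (with_proj (relabel f G))"
    using assms(1) connected_iff_rtrancl[OF G]
    by (auto simp: tree_graph_def connected_iff_rtrancl[OF H])
  moreover have False
    if p: "pre_digraph.cycle (with_proj (relabel f G)) p" "3 \<le> length p" for p
  proof -
    have sub: "set p \<subseteq> map_prod f f ` parcs G"
      using p(1) cycle_with_proj_iff[OF pair_graph_imp_pair_wf_digraph[OF H]] by simp
    have "pre_digraph.cycle (with_proj G) (map (map_prod (inv f) (inv f)) p)"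
    proof (rule cycle_map[OF pair_graph_imp_pair_wf_digraph[OF H]
          pair_graph_imp_pair_wf_digraph[OF G] p(1)])
      show "map_prod (inv f) (inv f) ` set p \<subseteq> parcs G"
        using sub assms(2) by fastforce
      have "snd ` set p \<subseteq> range f"
        using sub by fastforce
      then show "inj_on (inv f) (snd ` set p)"
        by (rule inj_on_inv_into)
    qed
    then show False
      using assms(1) p(2) unfolding tree_graph_def by (metis length_map)
  qed
  ultimately show ?thesis
    using H by (auto simp: tree_graph_def)
qed

text \<open>
  A cycle entering the pendant vertex \<open>Inr v\<close> has to come from \<open>Inl v\<close> and to return there
  at once, so that it has length 2.
\<close>

lemma cycle_pendant_graph_snd_Inl:
  assumes "pair_graph G" "pre_digraph.cycle (with_proj (pendant_graph G)) p" "3 \<le> length p"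
    and "i < length p"
  shows "snd (p ! i) \<in> range Inl"
proof (rule ccontr)
  let ?L = "length p"
  assume "snd (p ! i) \<notin> range Inl"
  then obtain v where v: "snd (p ! i) = Inr v"
    by (metis obj_sumE rangeI)
  have p: "set p \<subseteq> parcs (pendant_graph G)" "distinct (map snd p)"
      "pcas (fst (hd p)) p (fst (hd p))"
    using assms(2) cycle_with_proj_iff[OF pair_graph_imp_pair_wf_digraph[OF
        pair_graph_pendant_graph[OF assms(1)]]] by auto
  define j where "j = Suc i mod ?L"
  define h where "h = (if i = 0 then ?L - 1 else i - 1)"
  \<comment> \<open>\<open>j\<close> and \<open>h\<close> are the cyclic successor and predecessor
    of \<open>i\<close>; they differ because the length is at least 3.\<close>
  have jh: "j < ?L" "h < ?L" "Suc h mod ?L = i" "j \<noteq> h"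
    using assms(3,4) by (auto simp: j_def h_def mod_Suc split: if_splits)
  have "p ! i \<in> parcs (pendant_graph G)" "p ! j \<in> parcs (pendant_graph G)"
    using p(1) assms(4) jh(1) by auto
  moreover have "fst (p ! j) = Inr v"
    using pcas_closed_nth[OF p(3) assms(4)] v by (simp add: j_def)
  ultimately have "snd (p ! j) = Inl v" "fst (p ! i) = Inl v"
    using v by (auto simp: pendant_graph_def)
  moreover have "fst (p ! i) = snd (p ! h)"
    using pcas_closed_nth[OF p(3) jh(2)] jh(3) by simp
  ultimately have "map snd p ! j = map snd p ! h"
    using jh(1,2) by simp
  then show False
    using p(2) jh by (simp add: nth_eq_iff_index_eq del: nth_map)
qed

text \<open>Each vertex is linked to its copy in \<open>G\<close>, which gives connectedness. A
  cycle of length at least 3 avoids the pendant vertices and therefore projects to a cycle of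
  \<open>G\<close> of the same length.\<close>

lemma tree_graph_pendant_graph:
  assumes "tree_graph G"
  shows "tree_graph (pendant_graph G)"
proof -
  have G: "pair_graph G"
    using assms by (simp add: tree_graph_def)
  interpret pair_graph G by fact
  have H: "pair_graph (pendant_graph G)"
    by (rule pair_graph_pendant_graph[OF G])
  let ?R = "parcs (pendant_graph G)"
  let ?root = "case_sum id id :: 'a + 'a \<Rightarrow> 'a"
  have *: "(Inl u, Inl v) \<in> ?R\<^sup>*" if "u \<in> pverts G" "v \<in> pverts G" for u v
    by (rule rtrancl_map[of _ _ "parcs G"])
       (use that assms connected_iff_rtrancl[OF G] in \<open>auto simp: tree_graph_def pendant_graph_def\<close>)
  have up: "(w, Inl (?root w)) \<in> ?R\<^sup>*" "(Inl (?root w), w) \<in> ?R\<^sup>*" "?root w \<in> pverts G"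
    if "w \<in> pverts (pendant_graph G)" for w
    using that by (auto simp: pendant_graph_def)
  have "(w, w') \<in> ?R\<^sup>*" if "w \<in> pverts (pendant_graph G)" "w' \<in> pverts (pendant_graph G)" for w w'
    using up[OF that(1)] up[OF that(2)] * by (meson rtrancl_trans)
  moreover have "pverts (pendant_graph G) \<noteq> {}"
    using assms connected_iff_rtrancl[OF G] by (auto simp: tree_graph_def pendant_graph_def)
  ultimately have "Digraph_Component.connected (with_proj (pendant_graph G))"
    by (simp add: connected_iff_rtrancl[OF H])
  moreover have False
    if p: "pre_digraph.cycle (with_proj (pendant_graph G)) p" "3 \<le> length p" for p
  proof -
    have c: "set p \<subseteq> ?R" "pcas (fst (hd p)) p (fst (hd p))"
      using p(1) cycle_with_proj_iff[OF pair_graph_imp_pair_wf_digraph[OF H]] by auto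
    have Inl: "fst e \<in> range Inl \<and> snd e \<in> range Inl" if e: "e \<in> set p" for e
    proof -
      obtain i where i: "i < length p" "e = p ! i"
        using e by (auto simp: in_set_conv_nth)
      \<comment> \<open>The tail of an arc is the head of its cyclic predecessor, so the statement
        about heads covers the tails too.\<close>
      define h where "h = (if i = 0 then length p - 1 else i - 1)"
      have h: "h < length p" "Suc h mod length p = i"
        using i(1) by (auto simp: h_def)
      show ?thesis
        using cycle_pendant_graph_snd_Inl[OF G p i(1)] cycle_pendant_graph_snd_Inl[OF G p h(1)]
          pcas_closed_nth[OF c(2) h(1)] h(2) i(2) by simp
    qed
    have "pre_digraph.cycle (with_proj G) (map (map_prod ?root ?root) p)"
    proof (rule cycle_map[OF pair_graph_imp_pair_wf_digraph[OF H]
          pair_graph_imp_pair_wf_digraph[OF G] p(1)])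
      show "map_prod ?root ?root ` set p \<subseteq> parcs G"
      proof
        fix e' assume "e' \<in> map_prod ?root ?root ` set p"
        then obtain e where e: "e \<in> set p" "e' = map_prod ?root ?root e"
          by auto
        then have "e \<in> ?R" "fst e \<in> range Inl" "snd e \<in> range Inl"
          using c(1) Inl by auto
        then show "e' \<in> parcs G"
          by (auto simp: e(2) pendant_graph_def)
      qed
      show "inj_on ?root (snd ` set p)"
      proof (rule inj_onI)
        fix w w' assume "w \<in> snd ` set p" "w' \<in> snd ` set p" and eq: "?root w = ?root w'"
        then have "w \<in> range Inl" "w' \<in> range Inl"
          using Inl by auto
        with eq show "w = w'"
          by auto
      qed
    qed
    then show False
      using assms p(2) unfolding tree_graph_def by (metis length_map)
  qed
  ultimately show ?thesis
    using H by (auto simp: tree_graph_def)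
qed

section \<open>Trees obtained by iterating the pendant construction\<close>

definition single_vertex_graph :: "nat pair_pre_digraph" where
  "single_vertex_graph = \<lparr>pverts = {0}, parcs = {}\<rparr>"

lemma pair_graph_single_vertex_graph: "pair_graph single_vertex_graph"
  by unfold_locales (auto simp: single_vertex_graph_def symmetric_def sym_def)

lemma tree_graph_single_vertex_graph: "tree_graph single_vertex_graph"
proof -
  note G = pair_graph_single_vertex_graph
  have "Digraph_Component.connected (with_proj single_vertex_graph)"
    unfolding connected_iff_rtrancl[OF G] by (simp add: single_vertex_graph_def)
  moreover have "\<not> pre_digraph.cycle (with_proj single_vertex_graph) p" for p
    unfolding cycle_with_proj_iff[OF pair_graph_imp_pair_wf_digraph[OF G]]
    by (simp add: single_vertex_graph_def)
  ultimately show ?thesis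
    using G by (simp add: tree_graph_def)
qed

lemma stable_set_single_vertex_graph:
  "stable_set single_vertex_graph S \<longleftrightarrow> S = {} \<or> S = {0}"
  by (auto simp: stable_set_def single_vertex_graph_def)

lemma poly_indep_poly_single_vertex_graph:
  "poly (indep_poly single_vertex_graph) x = 1 + x"
proof -
  have "{S. stable_set single_vertex_graph S} = {{}, {0}}"
    by (auto simp: stable_set_single_vertex_graph)
  then show ?thesis
    by (simp add: poly_indep_poly single_vertex_graph_def)
qed

lemma well_covered_single_vertex_graph: "well_covered single_vertex_graph"
  by (auto simp: well_covered_def maximal_stable_set_def stable_set_single_vertex_graph)

text \<open>
  The map \<open>x / (1 + x)\<close> sends \<open>- 1 / (k + 1)\<close> to \<open>- 1 / k\<close>; hence attaching pendant
  edges repeatedly, starting from a single vertex, reaches all these roots.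
\<close>

lemma well_covered_tree_with_root:
  assumes "k > 0"
  shows "\<exists>H :: nat pair_pre_digraph. tree_graph H \<and> well_covered H
    \<and> poly (indep_poly H) (- 1 / of_nat k :: 'c::field_char_0) = 0"
  using assms
proof (induction k rule: nat_induct_non_zero)
  case 1
  then show ?case
    using tree_graph_single_vertex_graph well_covered_single_vertex_graph
    by (intro exI[of _ single_vertex_graph]) (simp add: poly_indep_poly_single_vertex_graph)
next
  case (Suc k)
  then obtain H :: "nat pair_pre_digraph" where H: "tree_graph H"
      "poly (indep_poly H) (- 1 / of_nat k :: 'c) = 0"
    by blast
  \<comment> \<open>\<open>sum_encode\<close> injects \<open>nat + nat\<close> into
    \<open>nat\<close>, which keeps the vertex type of the induction.\<close>
  let ?H' = "relabel sum_encode (pendant_graph H)"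
  have inj: "inj sum_encode"
    by (rule inj_sum_encode)
  have fin: "finite (pverts H)"
    using H(1) by (simp add: tree_graph_def pair_graph_def pair_digraph_def pair_fin_digraph_def
        pair_fin_digraph_axioms_def)
  have "(of_nat (Suc k) :: 'c) \<noteq> 0" "(of_nat k :: 'c) \<noteq> 0"
    using Suc.hyps by (simp_all del: of_nat_Suc)
  then have "(- 1 / of_nat (Suc k) :: 'c) \<noteq> - 1"
      "(- 1 / of_nat (Suc k) :: 'c) / (1 + - 1 / of_nat (Suc k)) = - 1 / of_nat k"
    by (simp_all add: field_simps)
  then have "poly (indep_poly ?H') (- 1 / of_nat (Suc k) :: 'c) = 0"
    using H(2) poly_indep_poly_pendant_graph_moebius[OF fin, of "- 1 / of_nat (Suc k) :: 'c"]
    by (simp add: poly_indep_poly_relabel[OF inj finite_pverts_pendant_graph[OF fin]]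
        del: of_nat_Suc)
  moreover have "tree_graph ?H'" "well_covered ?H'"
    by (simp_all add: H(1) inj fin tree_graph_relabel tree_graph_pendant_graph
        well_covered_relabel well_covered_pendant_graph)
  ultimately show ?case
    by blast
qed

section \<open>Values and roots of \<open>I(G\<^sup>*; x)\<close>\<close>

theorem theorem4:
  fixes G :: "'a pair_pre_digraph" and n :: nat
  assumes "pair_graph G" and "card (pverts G) = n" and "parcs G \<noteq> {}"
  shows "
     \<comment> \<open>(i)\<close>
     (even (card {S. stable_set (pendant_graph G) S})
       \<and> 2 ^ (n - stability_number G) dvd card {S. stable_set (pendant_graph G) S}
       \<and> poly (indep_poly (pendant_graph G)) (1::complex)
           = of_nat (card {S. stable_set (pendant_graph G) S}))
   \<and>
     \<comment> \<open>(ii)\<close>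
     ((\<forall>x::complex. x \<notin> {-1, 0} \<longrightarrow>
          x ^ n * poly (indep_poly (pendant_graph G)) (1 / x)
            = (1 + x) ^ n * poly (indep_poly G) (1 / (1 + x)))
       \<and> (\<forall>x::complex. x \<noteq> -1 \<longrightarrow>
          poly (indep_poly (pendant_graph G)) x = (1 + x) ^ n * poly (indep_poly G) (x / (1 + x)))
       \<and> (\<forall>x::complex. x \<noteq> 0 \<longrightarrow>
          poly (indep_poly (pendant_graph G)) (x - 1) = x ^ n * poly (indep_poly G) (1 - 1 / x))
       \<and> poly (indep_poly (pendant_graph G)) (-2::complex) = (-1) ^ n * poly (indep_poly G) 2)
   \<and>
     \<comment> \<open>(iii)\<close>
     (\<exists>f. bij_betw f {x::complex. poly (indep_poly (pendant_graph G)) x = 0 \<and> x \<noteq> -1}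
                     {y::complex. poly (indep_poly G) y = 0}
          \<and> (\<forall>x. poly (indep_poly (pendant_graph G)) x = 0 \<and> x \<noteq> -1 \<longrightarrow>
                order x (indep_poly (pendant_graph G)) = order (f x) (indep_poly G)
                \<and> (x \<in> \<rat> \<longleftrightarrow> f x \<in> \<rat>)
                \<and> (x \<in> \<real> \<longleftrightarrow> f x \<in> \<real>)))
   \<and>
     \<comment> \<open>(iv)\<close>
     (poly (indep_poly (pendant_graph G)) (-1::complex) = 0
       \<and> order (-1::complex) (indep_poly (pendant_graph G))
           = stability_number (pendant_graph G) - stability_number G
       \<and> stability_number (pendant_graph G) - stability_number G \<ge> 1)
   \<and>
     \<comment> \<open>(v)\<close>
     (\<forall>k::nat. k > 0 \<longrightarrow>
         (\<exists>H :: nat pair_pre_digraph. tree_graph H \<and> well_covered H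
            \<and> poly (indep_poly H) (- 1 / of_nat k :: complex) = 0))
   \<and>
     \<comment> \<open>(vi)\<close>
     (\<forall>x::real. x < -1 \<longrightarrow>
         poly (indep_poly (pendant_graph G)) x \<noteq> 0
         \<and> (odd n \<longrightarrow> poly (indep_poly (pendant_graph G)) x < 0)
         \<and> (even n \<longrightarrow> poly (indep_poly (pendant_graph G)) x > 0))"
proof -
  interpret pair_graph G by fact
  note fin = pair_finite_verts
  let ?P = "indep_poly (pendant_graph G)" and ?\<alpha> = "stability_number G"
  have n: "card (pverts G) = n" by fact
  have lt: "?\<alpha> < n"
    using stability_number_less_order[OF assms(1,3)] n by simp
  have moebius: "poly ?P x = (1 + x) ^ n * poly (indep_poly G) (x / (1 + x))"
    if "x \<noteq> -1" for x :: "'c::field"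
    using poly_indep_poly_pendant_graph_moebius[OF fin that] n by simp

  have "2 ^ (n - ?\<alpha>) dvd card {S. stable_set (pendant_graph G) S}"
  proof -
    \<comment> \<open>Evaluation over \<open>nat\<close> makes every summand a power of 2 with
      exponent \<open>n - card S\<close>, which is at least \<open>n - ?\<alpha>\<close>.\<close>
    have "card {S. stable_set (pendant_graph G) S} = poly ?P (1 :: nat)"
      by (simp add: poly_indep_poly[OF finite_pverts_pendant_graph[OF fin]])
    also have "\<dots> = (\<Sum>S | stable_set G S. 2 ^ (n - card S))"
      by (simp add: poly_indep_poly_pendant_graph[OF fin] n numeral_2_eq_2)
    also have "2 ^ (n - ?\<alpha>) dvd \<dots>"
      by (rule dvd_sum)
         (use card_stable_set_le[OF fin] in \<open>auto intro!: le_imp_power_dvd diff_le_mono2\<close>)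
    finally show ?thesis .
  qed
  moreover have "even ((2 :: nat) ^ (n - ?\<alpha>))"
    using lt by simp
  moreover have "poly ?P (1 :: complex) = of_nat (card {S. stable_set (pendant_graph G) S})"
    by (simp add: poly_indep_poly[OF finite_pverts_pendant_graph[OF fin]])
  ultimately have i: "even (card {S. stable_set (pendant_graph G) S})
       \<and> 2 ^ (n - ?\<alpha>) dvd card {S. stable_set (pendant_graph G) S}
       \<and> poly ?P (1 :: complex) = of_nat (card {S. stable_set (pendant_graph G) S})"
    using dvd_trans by blast

  have ii1: "x ^ n * poly ?P (1 / x) = (1 + x) ^ n * poly (indep_poly G) (1 / (1 + x))"
    if x: "x \<notin> {-1, 0}" for x :: complex
  proof -
    have nz: "1 + x \<noteq> 0" "x \<noteq> 0"
      using x by (auto simp: add_eq_0_iff)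
    have "1 / x \<noteq> -1"
    proof
      assume "1 / x = -1"
      then have "1 / (1 / x) = 1 / (-1)"
        by simp
      then show False
        using x by simp
    qed
    moreover have "(1 / x) / (1 + 1 / x) = 1 / (1 + x)"
      using nz by (simp add: field_simps)
    moreover have "x ^ n * (1 + 1 / x) ^ n = (1 + x) ^ n"
      using nz by (simp add: field_simps flip: power_mult_distrib)
    ultimately show ?thesis
      using moebius[of "1 / x"] by (metis mult.assoc)
  qed
  have ii3: "poly ?P (x - 1) = x ^ n * poly (indep_poly G) (1 - 1 / x)"
    if "x \<noteq> 0" for x :: complex
    using moebius[of "x - 1"] that by (simp add: diff_divide_distrib)
  have ii4: "poly ?P (-2 :: complex) = (-1) ^ n * poly (indep_poly G) 2"
    using ii3[of "-1"] by simp

  have iii: "\<exists>f. bij_betw f {x::complex. poly ?P x = 0 \<and> x \<noteq> -1}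
        {y::complex. poly (indep_poly G) y = 0}
      \<and> (\<forall>x. poly ?P x = 0 \<and> x \<noteq> -1 \<longrightarrow> order x ?P = order (f x) (indep_poly G)
          \<and> (x \<in> \<rat> \<longleftrightarrow> f x \<in> \<rat>) \<and> (x \<in> \<real> \<longleftrightarrow> f x \<in> \<real>))"
  proof -
    \<comment> \<open>\<open>f\<close> maps the numbers other than -1 bijectively onto the numbers
      other than 1, with inverse \<open>g\<close>.\<close>
    define f :: "complex \<Rightarrow> complex" where "f = (\<lambda>x. x / (1 + x))"
    define g :: "complex \<Rightarrow> complex" where "g = (\<lambda>y. y / (1 - y))"
    have gf: "g (f x) = x" if "x \<noteq> -1" for x
    proof -
      have "1 + x \<noteq> 0"
        using that by (auto simp: add_eq_0_iff)
      moreover from this have "1 - x / (1 + x) = 1 / (1 + x)"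
        by (simp add: field_simps)
      ultimately show ?thesis
        by (simp add: f_def g_def)
    qed
    have fg: "f (g y) = y" "g y \<noteq> -1" if "y \<noteq> 1" for y
    proof -
      have nz: "1 - y \<noteq> 0"
        using that by simp
      then have eq: "1 + y / (1 - y) = 1 / (1 - y)"
        by (simp add: field_simps)
      then show "f (g y) = y"
        using nz by (simp add: f_def g_def)
      show "g y \<noteq> -1"
        using eq nz by (auto simp: g_def)
    qed
    \<comment> \<open>The value 1, which \<open>f\<close> misses, is no root: there
      \<open>indep_poly G\<close> counts the stable sets.\<close>
    have root_ne_1: "y \<noteq> 1" if "poly (indep_poly G) y = 0" for y :: complex
    proof
      assume "y = 1"
      then have "of_nat (card {S. stable_set G S}) = (0 :: complex)"
        using that by (simp add: poly_indep_poly[OF fin])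
      then show False
        using finite_stable_sets[OF fin] stable_set_empty[of G] by (auto simp del: stable_set_empty)
    qed
    have root_iff: "poly ?P x = 0 \<longleftrightarrow> poly (indep_poly G) (f x) = 0" if "x \<noteq> -1" for x
      using moebius[OF that] that by (auto simp: f_def add_eq_0_iff)
    show ?thesis
    proof (intro exI[of _ f] conjI allI impI)
      show "bij_betw f {x. poly ?P x = 0 \<and> x \<noteq> -1} {y. poly (indep_poly G) y = 0}"
        by (rule bij_betwI[where g = g]) (use gf fg root_ne_1 root_iff in auto)
      fix x :: complex assume x: "poly ?P x = 0 \<and> x \<noteq> -1"
      show "order x ?P = order (f x) (indep_poly G)"
        unfolding f_def
        by (rule order_moebius[OF moebius indep_poly_nonzero[OF fin]])
           (use x degree_indep_poly_le[OF fin] n in auto)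
      \<comment> \<open>Both \<open>f\<close> and its inverse \<open>g\<close> are built from field
        operations and the constant 1, so they preserve every subfield.\<close>
      show "x \<in> \<rat> \<longleftrightarrow> f x \<in> \<rat>"
      proof
        assume "f x \<in> \<rat>"
        then have "g (f x) \<in> \<rat>"
          unfolding g_def by simp
        then show "x \<in> \<rat>"
          using gf x by simp
      qed (simp add: f_def)
      show "x \<in> \<real> \<longleftrightarrow> f x \<in> \<real>"
      proof
        assume "f x \<in> \<real>"
        then have "g (f x) \<in> \<real>"
          unfolding g_def by simp
        then show "x \<in> \<real>"
          using gf x by simp
      qed (simp add: f_def)
    qed
  qed

  have ord: "order (-1 :: complex) ?P = stability_number (pendant_graph G) - ?\<alpha>"
    using order_minus_one_indep_poly_pendant_graph[OF fin] stability_number_pendant_graph[OF fin]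
    by simp
  have gap: "stability_number (pendant_graph G) - ?\<alpha> \<ge> 1"
    using stability_number_pendant_graph[OF fin] n lt by simp
  have iv: "poly ?P (-1 :: complex) = 0"
    using ord gap by (auto simp: order_root)

  have vi: "poly ?P x \<noteq> 0 \<and> (odd n \<longrightarrow> poly ?P x < 0) \<and> (even n \<longrightarrow> poly ?P x > 0)"
    if x: "x < -1" for x :: real
  proof -
    \<comment> \<open>Numerator and denominator are both negative. At a positive argument
      \<open>indep_poly G\<close> is a sum of positive terms, so the sign is that of
      \<open>(1 + x) ^ n\<close>.\<close>
    have "x / (1 + x) > 0"
      using x by (simp add: divide_neg_neg)
    then have "poly (indep_poly G) (x / (1 + x)) > 0"
      unfolding poly_indep_poly[OF fin]
      by (intro sum_pos) (use finite_stable_sets[OF fin] in \<open>auto intro: stable_set_empty\<close>)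
    moreover have "odd n \<Longrightarrow> (1 + x) ^ n < 0" "even n \<Longrightarrow> (1 + x) ^ n > 0"
      using x by (auto simp: power_less_zero_eq zero_less_power_eq)
    ultimately show ?thesis
      using moebius[of x] x
      by (cases "even n") (auto simp: mult_less_0_iff zero_less_mult_iff)
  qed

  have v: "\<exists>H :: nat pair_pre_digraph. tree_graph H \<and> well_covered H
      \<and> poly (indep_poly H) (- 1 / of_nat k :: complex) = 0" if "k > 0" for k
    using that by (rule well_covered_tree_with_root)

  show ?thesis
    by (intro conjI allI impI iii ii1 moebius ii3 ii4 ord gap iv v; (assumption | use i vi in blast))
qed

end
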